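(* If a category $\mathbf{C}$ is action Barr-exact, then it satisfies $\mathrm{OST}$.
   Context: For a category $\mathbf{C}$ with finite limits, $\mathrm{Grp}(\mathbf{C})$ is the category of group objects (with multiplication $m_G$). For $G\in\mathrm{Grp}(\mathbf{C})$, a $G$-object is an object $X$ with a left action $a\colon G\times X\to X$. The quotient $q\colon X\to G\backslash X$ is the coequaliser of $a,\mathrm{pr}_X\colon G\times X\rightrightarrows X$ (if it exists). The stabiliser $G_X$ is the equaliser of $a,\mathrm{pr}_X\colon G\times X\rightrightarrows X$, regarded as an object over $X$. For a section $s\colon G\backslash X\to X$ of $q$ (i.e. $q\circ s=\mathrm{id}$), $s^*G_X$ is the pullback of $G_X\to X$ along $s$. Action Barr-exact. In a regular category $\mathbf{C}$, if $G\in\mathrm{Grp}(\mathbf{C})$ acts on $X$, then the image $R\hookrightarrow X\times X$ in the (regular epi)-mono factorisation of $(a,\mathrm{pr}_X)\colon G\times X\to X\times X$ is a congruence (internal equivalence relation) on $X$. A regular category is action Barr-exact if every such congruence is effective (has a coequaliser and is the kernel pair of it). OST. $\mathbf{C}$ satisfies $\mathrm{OST}$ if for every $G\in\mathrm{Grp}(\mathbf{C})$ and every $G$-object $X$ the quotient $q\colon X\to G\backslash X$ exists and for every section $s$ of $q$ the diagram $G\times s^*G_X\rightrightarrows G\times(G\backslash X)\xrightarrow{a\circ(\mathrm{id}_G\times s)}X$ is a coequaliser in $\mathbf{C}$, where the two parallel maps are $\mathrm{id}_G\times(s^*G_X\to G\backslash X)$ and $G\times s^*G_X\to G\times G_X\to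 G\times G\times X\xrightarrow{m_G\times q}G\times(G\backslash X)$. (If $q$ has no section, there is no condition besides existence of the quotient.) *)

theory Defs
  imports Main
begin

record ('o, 'm) cat =
  Obj :: "'o set"
  Arr :: "'m set"
  Dom :: "'m \<Rightarrow> 'o"
  Cod :: "'m \<Rightarrow> 'o"
  Id :: "'o \<Rightarrow> 'm"
  Comp :: "'m \<Rightarrow> 'm \<Rightarrow> 'm" (infixr "\<cdot>\<index>" 75)

definition hom :: "('o, 'm) cat \<Rightarrow> 'o \<Rightarrow> 'o \<Rightarrow> 'm set" where
  "hom C A B = {f \<in> Arr C. Dom C f = A \<and> Cod C f = B}"

text \<open>Composition is written in the order of functions, so \<open>g \<cdot> f\<close> is \<open>g\<close> after \<open>f\<close>; its
  value is irrelevant for non-composable arguments.\<close>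

locale category =
  fixes C :: "('o, 'm) cat" (structure)
  assumes Dom_in_Obj: "f \<in> Arr C \<Longrightarrow> Dom C f \<in> Obj C"
    and Cod_in_Obj: "f \<in> Arr C \<Longrightarrow> Cod C f \<in> Obj C"
    and Id_in_hom: "A \<in> Obj C \<Longrightarrow> Id C A \<in> hom C A A"
    and Comp_in_hom: "\<lbrakk>f \<in> hom C A B; g \<in> hom C B D\<rbrakk> \<Longrightarrow> g \<cdot> f \<in> hom C A D"
    and Comp_Id: "f \<in> hom C A B \<Longrightarrow> f \<cdot> Id C A = f"
    and Id_Comp: "f \<in> hom C A B \<Longrightarrow> Id C B \<cdot> f = f"
    and Comp_assoc: "\<lbrakk>f \<in> hom C A B; g \<in> hom C B D; h \<in> hom C D E\<rbrakk>
      \<Longrightarrow> (h \<cdot> g) \<cdot> f = h \<cdot> (g \<cdot> f)"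

definition is_functor ::
    "('i, 'j) cat \<Rightarrow> ('o, 'm) cat \<Rightarrow> ('i \<Rightarrow> 'o) \<Rightarrow> ('j \<Rightarrow> 'm) \<Rightarrow> bool" where
  "is_functor J C Fo Fa \<longleftrightarrow>
     (\<forall>i \<in> Obj J. Fo i \<in> Obj C) \<and>
     (\<forall>u \<in> Arr J. Fa u \<in> hom C (Fo (Dom J u)) (Fo (Cod J u))) \<and>
     (\<forall>i \<in> Obj J. Fa (Id J i) = Id C (Fo i)) \<and>
     (\<forall>u \<in> Arr J. \<forall>v \<in> Arr J. Cod J u = Dom J v \<longrightarrow>
        Fa (Comp J v u) = Comp C (Fa v) (Fa u))"

definition is_cone ::
    "('i, 'j) cat \<Rightarrow> ('o, 'm) cat \<Rightarrow> ('i \<Rightarrow> 'o) \<Rightarrow> ('j \<Rightarrow> 'm) \<Rightarrow> 'o \<Rightarrow> ('i \<Rightarrow> 'm) \<Rightarrow> bool" where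
  "is_cone J C Fo Fa L p \<longleftrightarrow>
     L \<in> Obj C \<and>
     (\<forall>i \<in> Obj J. p i \<in> hom C L (Fo i)) \<and>
     (\<forall>u \<in> Arr J. Comp C (Fa u) (p (Dom J u)) = p (Cod J u))"

definition is_limit ::
    "('i, 'j) cat \<Rightarrow> ('o, 'm) cat \<Rightarrow> ('i \<Rightarrow> 'o) \<Rightarrow> ('j \<Rightarrow> 'm) \<Rightarrow> 'o \<Rightarrow> ('i \<Rightarrow> 'm) \<Rightarrow> bool" where
  "is_limit J C Fo Fa L p \<longleftrightarrow>
     is_cone J C Fo Fa L p \<and>
     (\<forall>M r. is_cone J C Fo Fa M r \<longrightarrow>
        (\<exists>!h. h \<in> hom C M L \<and> (\<forall>i \<in> Obj J. Comp C (p i) h = r i)))"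

text \<open>Every finite category is isomorphic to one whose objects and arrows are natural numbers,
  so it is enough to take these as shapes of finite diagrams.\<close>

definition has_finite_limits :: "('o, 'm) cat \<Rightarrow> bool" where
  "has_finite_limits C \<longleftrightarrow>
     (\<forall>(J :: (nat, nat) cat) Fo Fa.
        category J \<and> finite (Obj J) \<and> finite (Arr J) \<and> is_functor J C Fo Fa \<longrightarrow>
        (\<exists>L p. is_limit J C Fo Fa L p))"

context category
begin

definition is_terminal :: "'o \<Rightarrow> bool" where
  "is_terminal T \<longleftrightarrow> T \<in> Obj C \<and> (\<forall>A \<in> Obj C. \<exists>!f. f \<in> hom C A T)"

definition is_product :: "'o \<Rightarrow> 'o \<Rightarrow> 'o \<Rightarrow> 'm \<Rightarrow> 'm \<Rightarrow> bool" where
  "is_product A B P p1 p2 \<longleftrightarrow>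
     p1 \<in> hom C P A \<and> p2 \<in> hom C P B \<and>
     (\<forall>Z f g. f \<in> hom C Z A \<and> g \<in> hom C Z B \<longrightarrow>
        (\<exists>!h. h \<in> hom C Z P \<and> p1 \<cdot> h = f \<and> p2 \<cdot> h = g))"

definition parallel :: "'m \<Rightarrow> 'm \<Rightarrow> bool" where
  "parallel f g \<longleftrightarrow> f \<in> Arr C \<and> g \<in> Arr C \<and> Dom C f = Dom C g \<and> Cod C f = Cod C g"

definition is_equaliser :: "'m \<Rightarrow> 'm \<Rightarrow> 'o \<Rightarrow> 'm \<Rightarrow> bool" where
  "is_equaliser f g E i \<longleftrightarrow>
     parallel f g \<and> i \<in> hom C E (Dom C f) \<and> f \<cdot> i = g \<cdot> i \<and>
     (\<forall>Z k. k \<in> hom C Z (Dom C f) \<and> f \<cdot> k = g \<cdot> k \<longrightarrow>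
        (\<exists>!h. h \<in> hom C Z E \<and> i \<cdot> h = k))"

definition is_coequaliser :: "'m \<Rightarrow> 'm \<Rightarrow> 'o \<Rightarrow> 'm \<Rightarrow> bool" where
  "is_coequaliser f g Q q \<longleftrightarrow>
     parallel f g \<and> q \<in> hom C (Cod C f) Q \<and> q \<cdot> f = q \<cdot> g \<and>
     (\<forall>Z k. k \<in> hom C (Cod C f) Z \<and> k \<cdot> f = k \<cdot> g \<longrightarrow>
        (\<exists>!h. h \<in> hom C Q Z \<and> h \<cdot> q = k))"

definition is_pullback :: "'m \<Rightarrow> 'm \<Rightarrow> 'o \<Rightarrow> 'm \<Rightarrow> 'm \<Rightarrow> bool" where
  "is_pullback f g P p1 p2 \<longleftrightarrow>
     f \<in> Arr C \<and> g \<in> Arr C \<and> Cod C f = Cod C g \<and>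
     p1 \<in> hom C P (Dom C f) \<and> p2 \<in> hom C P (Dom C g) \<and> f \<cdot> p1 = g \<cdot> p2 \<and>
     (\<forall>Z k l. k \<in> hom C Z (Dom C f) \<and> l \<in> hom C Z (Dom C g) \<and> f \<cdot> k = g \<cdot> l \<longrightarrow>
        (\<exists>!h. h \<in> hom C Z P \<and> p1 \<cdot> h = k \<and> p2 \<cdot> h = l))"

definition is_kernel_pair :: "'m \<Rightarrow> 'o \<Rightarrow> 'm \<Rightarrow> 'm \<Rightarrow> bool" where
  "is_kernel_pair f R r1 r2 \<longleftrightarrow> is_pullback f f R r1 r2"

definition is_mono :: "'m \<Rightarrow> bool" where
  "is_mono f \<longleftrightarrow> f \<in> Arr C \<and>
     (\<forall>Z k l. k \<in> hom C Z (Dom C f) \<and> l \<in> hom C Z (Dom C f) \<and> f \<cdot> k = f \<cdot> l \<longrightarrow> k = l)"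

definition is_regular_epi :: "'m \<Rightarrow> bool" where
  "is_regular_epi e \<longleftrightarrow> (\<exists>f g. is_coequaliser f g (Cod C e) e)"

definition is_section :: "'m \<Rightarrow> 'm \<Rightarrow> bool" where
  "is_section q s \<longleftrightarrow> q \<in> Arr C \<and> s \<in> hom C (Cod C q) (Dom C q) \<and> q \<cdot> s = Id C (Cod C q)"

end

text \<open>Binary products and the terminal object are fixed by choice, which is meaningful in
  the presence of finite limits.  All other limits and colimits below range over all
  representatives.\<close>

locale finitely_complete_category = category C for C :: "('o, 'm) cat" (structure) +
  assumes finite_limits: "has_finite_limits C"
begin

definition terminal_obj :: "'o" ("\<one>") where
  "\<one> = (SOME T. is_terminal T)"

definition bang :: "'o \<Rightarrow> 'm" where
  "bang A = (THE f. f \<in> hom C A \<one>)"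

definition product_cone :: "'o \<Rightarrow> 'o \<Rightarrow> 'o \<times> 'm \<times> 'm" where
  "product_cone A B = (SOME (P, p1, p2). is_product A B P p1 p2)"

definition product_obj :: "'o \<Rightarrow> 'o \<Rightarrow> 'o" (infixr "\<otimes>" 80) where
  "A \<otimes> B = fst (product_cone A B)"

definition pr1 :: "'o \<Rightarrow> 'o \<Rightarrow> 'm" where
  "pr1 A B = fst (snd (product_cone A B))"

definition pr2 :: "'o \<Rightarrow> 'o \<Rightarrow> 'm" where
  "pr2 A B = snd (snd (product_cone A B))"

definition pairing :: "'m \<Rightarrow> 'm \<Rightarrow> 'm" ("\<langle>_, _\<rangle>") where
  "\<langle>f, g\<rangle> = (THE h. h \<in> hom C (Dom C f) (Cod C f \<otimes> Cod C g) \<and>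
     pr1 (Cod C f) (Cod C g) \<cdot> h = f \<and> pr2 (Cod C f) (Cod C g) \<cdot> h = g)"

definition product_map :: "'m \<Rightarrow> 'm \<Rightarrow> 'm" (infixr "\<otimes>\<^sub>m" 80) where
  "f \<otimes>\<^sub>m g = \<langle>f \<cdot> pr1 (Dom C f) (Dom C g), g \<cdot> pr2 (Dom C f) (Dom C g)\<rangle>"

text \<open>The canonical isomorphism \<open>A \<otimes> (B \<otimes> D) \<rightarrow> (A \<otimes> B) \<otimes> D\<close>.\<close>

definition assoc :: "'o \<Rightarrow> 'o \<Rightarrow> 'o \<Rightarrow> 'm" where
  "assoc A B D =
     \<langle>\<langle>pr1 A (B \<otimes> D), pr1 B D \<cdot> pr2 A (B \<otimes> D)\<rangle>, pr2 B D \<cdot> pr2 A (B \<otimes> D)\<rangle>"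

definition is_group_object :: "'o \<Rightarrow> 'm \<Rightarrow> 'm \<Rightarrow> 'm \<Rightarrow> bool" where
  "is_group_object G m e i \<longleftrightarrow>
     G \<in> Obj C \<and> m \<in> hom C (G \<otimes> G) G \<and> e \<in> hom C \<one> G \<and> i \<in> hom C G G \<and>
     m \<cdot> (m \<otimes>\<^sub>m Id C G) \<cdot> assoc G G G = m \<cdot> (Id C G \<otimes>\<^sub>m m) \<and>
     m \<cdot> \<langle>e \<cdot> bang G, Id C G\<rangle> = Id C G \<and>
     m \<cdot> \<langle>Id C G, e \<cdot> bang G\<rangle> = Id C G \<and>
     m \<cdot> \<langle>i, Id C G\<rangle> = e \<cdot> bang G \<and>
     m \<cdot> \<langle>Id C G, i\<rangle> = e \<cdot> bang G"

definition is_action :: "'o \<Rightarrow> 'm \<Rightarrow> 'm \<Rightarrow> 'o \<Rightarrow> 'm \<Rightarrow> bool" where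
  "is_action G m e X a \<longleftrightarrow>
     X \<in> Obj C \<and> a \<in> hom C (G \<otimes> X) X \<and>
     a \<cdot> (m \<otimes>\<^sub>m Id C X) \<cdot> assoc G G X = a \<cdot> (Id C G \<otimes>\<^sub>m a) \<and>
     a \<cdot> \<langle>e \<cdot> bang X, Id C X\<rangle> = Id C X"

definition is_quotient :: "'o \<Rightarrow> 'o \<Rightarrow> 'm \<Rightarrow> 'o \<Rightarrow> 'm \<Rightarrow> bool" where
  "is_quotient G X a Q q \<longleftrightarrow> is_coequaliser a (pr2 G X) Q q"

text \<open>\<open>S\<close> is the stabiliser with its inclusion \<open>\<iota>\<close> into \<open>G \<otimes> X\<close>; its structure map to \<open>X\<close> is
  \<open>pr2 G X \<cdot> \<iota>\<close>, which equals \<open>a \<cdot> \<iota>\<close>.\<close>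

definition is_stabiliser :: "'o \<Rightarrow> 'o \<Rightarrow> 'm \<Rightarrow> 'o \<Rightarrow> 'm \<Rightarrow> bool" where
  "is_stabiliser G X a S \<iota> \<longleftrightarrow> is_equaliser a (pr2 G X) S \<iota>"

definition is_image_factorisation :: "'m \<Rightarrow> 'o \<Rightarrow> 'm \<Rightarrow> 'm \<Rightarrow> bool" where
  "is_image_factorisation f R p j \<longleftrightarrow>
     p \<in> hom C (Dom C f) R \<and> j \<in> hom C R (Cod C f) \<and>
     is_regular_epi p \<and> is_mono j \<and> j \<cdot> p = f"

definition is_effective :: "'o \<Rightarrow> 'm \<Rightarrow> 'm \<Rightarrow> bool" where
  "is_effective R r1 r2 \<longleftrightarrow> (\<exists>Q q. is_coequaliser r1 r2 Q q \<and> is_kernel_pair q R r1 r2)"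

end

locale regular_category = finitely_complete_category C for C :: "('o, 'm) cat" (structure) +
  assumes kernel_pair_coequaliser:
      "is_kernel_pair f R r1 r2 \<Longrightarrow> \<exists>Q q. is_coequaliser r1 r2 Q q"
    and regular_epi_pullback_stable:
      "\<lbrakk>is_regular_epi f; is_pullback f g P p1 p2\<rbrakk> \<Longrightarrow> is_regular_epi p2"

text \<open>In a regular category the image \<open>j : R \<rightarrow> X \<otimes> X\<close> below always is a congruence on \<open>X\<close>, so
  being one is not a separate hypothesis.\<close>

locale action_Barr_exact_category = regular_category C for C :: "('o, 'm) cat" (structure) +
  assumes action_image_effective:
    "\<lbrakk>is_group_object G m e i; is_action G m e X a;
      is_image_factorisation \<langle>a, pr2 G X\<rangle> R p j\<rbrakk>
      \<Longrightarrow> is_effective R (pr1 X X \<cdot> j) (pr2 X X \<cdot> j)"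

text \<open>For generalised elements, the two parallel maps of the coequaliser diagram are
  \<open>(g, (h, y)) \<mapsto> (g, y)\<close> and \<open>(g, (h, y)) \<mapsto> (g h, y)\<close>, where \<open>P\<close> (with projections \<open>u\<close>, \<open>v\<close>) is
  the pullback of the stabiliser \<open>S \<rightarrow> X\<close> along the section \<open>s\<close>.\<close>

locale OST_category = finitely_complete_category C for C :: "('o, 'm) cat" (structure) +
  assumes quotient_exists:
      "\<lbrakk>is_group_object G m e i; is_action G m e X a\<rbrakk> \<Longrightarrow> \<exists>Q q. is_quotient G X a Q q"
    and orbit_stabiliser:
      "\<lbrakk>is_group_object G m e i; is_action G m e X a;
        is_quotient G X a Q q; is_section q s;
        is_stabiliser G X a S \<iota>; is_pullback s (pr2 G X \<cdot> \<iota>) P u v\<rbrakk>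
        \<Longrightarrow> is_coequaliser
              (Id C G \<otimes>\<^sub>m u)
              ((m \<otimes>\<^sub>m q) \<cdot> assoc G G X \<cdot> (Id C G \<otimes>\<^sub>m \<iota>) \<cdot> (Id C G \<otimes>\<^sub>m v))
              X (a \<cdot> (Id C G \<otimes>\<^sub>m s))"

end

theory Submission
  imports Defs
begin

text \<open>
  Let \<open>G\<close> act on \<open>X\<close>, and let \<open>p : G \<otimes> X \<rightarrow> R\<close> be the regular epimorphism onto the image of
  \<open>\<langle>a, pr2\<rangle>\<close>, the orbit relation on \<open>X\<close>. As \<open>p\<close> is epic, the quotients of \<open>X\<close> by \<open>G\<close> are exactly the
  coequalisers of the two projections \<open>R \<rightarrow> X\<close> (\<open>quotient_via_image\<close>). Exactness provides one of
  which \<open>R\<close> is the kernel pair, and then \<open>R\<close> is the kernel pair of every quotient map \<open>q\<close>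
  (\<open>effective_kernel_pair\<close>): two points with the same class are related by \<open>G\<close>, locally on a cover.

  Now let \<open>s\<close> be a section of \<open>q\<close>. Every point \<open>z\<close> is equivalent to \<open>s(q(z))\<close>, so \<open>z \<mapsto> (z, s(q(z)))\<close>
  is an arrow \<open>X \<rightarrow> R\<close>. The pullback of \<open>p\<close> along it is the orbit map \<open>(g, y) \<mapsto> g s(y)\<close>, which is
  therefore a regular epimorphism (\<open>orbit_map_regular_epi\<close>). The rest is the orbit-stabiliser
  argument: \<open>g s(y) = g' s(y')\<close> holds exactly if \<open>y = y'\<close> and \<open>g\<close>, \<open>g'\<close> differ by an element of the
  stabiliser of \<open>s(y)\<close> (\<open>orbit_map_eq_factor\<close>). So the pair of maps built from the stabiliser has the orbit map
  as its coequaliser (\<open>orbit_map_coequaliser\<close>).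

  Points here are generalised elements, that is, arrows from an arbitrary object. The group
  calculations are made with them by means of the rule \<open>\<langle>f, g\<rangle> \<cdot> h = \<langle>f \<cdot> h, g \<cdot> h\<rangle>\<close>.
\<close>

section \<open>Arrows and universal properties\<close>

context category
begin

text \<open>Typing is expressed through \<open>Arr\<close>, \<open>Dom\<close> and \<open>Cod\<close> instead of \<open>hom\<close>, since the side conditions of
  the rewrite rules then contain no variable that is absent from the term to be rewritten.\<close>

lemma in_hom_iff: "f \<in> hom C A B \<longleftrightarrow> f \<in> Arr C \<and> Dom C f = A \<and> Cod C f = B"
  by (simp add: hom_def)

lemma Id_simps [simp]:
  assumes "A \<in> Obj C"
  shows "Id C A \<in> Arr C" "Dom C (Id C A) = A" "Cod C (Id C A) = A"
  using Id_in_hom[OF assms] by (simp_all add: in_hom_iff)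

lemma Comp_simps [simp]:
  assumes "f \<in> Arr C" "g \<in> Arr C" "Cod C f = Dom C g"
  shows "g \<cdot> f \<in> Arr C" "Dom C (g \<cdot> f) = Dom C f" "Cod C (g \<cdot> f) = Cod C g"
  using Comp_in_hom[of f "Dom C f" "Dom C g" g "Cod C g"] assms by (simp_all add: in_hom_iff)

lemma Comp_Id_right [simp]: "f \<in> Arr C \<Longrightarrow> Dom C f = A \<Longrightarrow> f \<cdot> Id C A = f"
  using Comp_Id[of f A "Cod C f"] by (simp add: in_hom_iff)

lemma Comp_Id_left [simp]: "f \<in> Arr C \<Longrightarrow> Cod C f = A \<Longrightarrow> Id C A \<cdot> f = f"
  using Id_Comp[of f "Dom C f" A] by (simp add: in_hom_iff)

lemma Comp_assoc_right [simp]: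
  assumes "f \<in> Arr C" "g \<in> Arr C" "h \<in> Arr C" "Cod C f = Dom C g" "Cod C g = Dom C h"
  shows "(h \<cdot> g) \<cdot> f = h \<cdot> (g \<cdot> f)"
  using Comp_assoc[of f "Dom C f" "Dom C g" g "Dom C h" h "Cod C h"] assms
  by (simp add: in_hom_iff)

lemmas Dom_Cod_in_Obj [simp] = Dom_in_Obj Cod_in_Obj

lemma pullback_simps:
  assumes "is_pullback f g P p1 p2"
  shows "f \<in> Arr C" "g \<in> Arr C" "Cod C f = Cod C g"
    "p1 \<in> Arr C" "Dom C p1 = P" "Cod C p1 = Dom C f"
    "p2 \<in> Arr C" "Dom C p2 = P" "Cod C p2 = Dom C g" "f \<cdot> p1 = g \<cdot> p2"
  using assms unfolding is_pullback_def in_hom_iff by auto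

lemma pullback_factor:
  assumes "is_pullback f g P p1 p2" "k \<in> Arr C" "l \<in> Arr C" "Dom C k = Dom C l"
    "Cod C k = Dom C f" "Cod C l = Dom C g" "f \<cdot> k = g \<cdot> l"
  obtains h where "h \<in> Arr C" "Dom C h = Dom C l" "Cod C h = P" "p1 \<cdot> h = k" "p2 \<cdot> h = l"
  using assms unfolding is_pullback_def in_hom_iff by metis

lemma pullback_joint_mono:
  assumes P: "is_pullback f g P p1 p2"
    and "h \<in> Arr C" "k \<in> Arr C" "Dom C h = Dom C k" "Cod C h = P" "Cod C k = P"
    and eq: "p1 \<cdot> h = p1 \<cdot> k" "p2 \<cdot> h = p2 \<cdot> k"
  shows "h = k"
proof -
  note [simp] = pullback_simps(1-9)[OF P] assms(2-6)
  have "(f \<cdot> p1) \<cdot> k = (g \<cdot> p2) \<cdot> k"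
    by (simp only: pullback_simps(10)[OF P])
  then have "f \<cdot> (p1 \<cdot> k) = g \<cdot> (p2 \<cdot> k)"
    by simp
  moreover have "p1 \<cdot> k \<in> hom C (Dom C k) (Dom C f)" "p2 \<cdot> k \<in> hom C (Dom C k) (Dom C g)"
    by (simp_all add: in_hom_iff)
  ultimately have "\<exists>!h. h \<in> hom C (Dom C k) P \<and> p1 \<cdot> h = p1 \<cdot> k \<and> p2 \<cdot> h = p2 \<cdot> k"
    using P unfolding is_pullback_def by blast
  moreover have "h \<in> hom C (Dom C k) P" "k \<in> hom C (Dom C k) P"
    by (simp_all add: in_hom_iff)
  ultimately show ?thesis
    using eq by blast
qed

text \<open>As composites are normalised to the right, an equation \<open>g \<cdot> f = k\<close> no longer matches inside
  \<open>g \<cdot> (f \<cdot> h)\<close>; this form of associativity applies it there.\<close>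

lemma Comp_assoc_eq:
  assumes "g \<cdot> f = k" "f \<in> Arr C" "g \<in> Arr C" "h \<in> Arr C" "Cod C h = Dom C f" "Cod C f = Dom C g"
  shows "g \<cdot> (f \<cdot> h) = k \<cdot> h"
  using assms Comp_assoc_right by metis

lemma coequaliser_simps:
  assumes "is_coequaliser f g Q q"
  shows "f \<in> Arr C" "g \<in> Arr C" "Dom C f = Dom C g" "Cod C f = Cod C g"
    "q \<in> Arr C" "Dom C q = Cod C f" "Cod C q = Q" "q \<cdot> f = q \<cdot> g"
  using assms unfolding is_coequaliser_def parallel_def in_hom_iff by auto

lemma coequaliser_factor:
  assumes "is_coequaliser f g Q q" "k \<in> Arr C" "Dom C k = Cod C f" "k \<cdot> f = k \<cdot> g"
  obtains h where "h \<in> Arr C" "Dom C h = Q" "Cod C h = Cod C k" "h \<cdot> q = k"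
  using assms unfolding is_coequaliser_def in_hom_iff by metis

lemma coequaliser_epi:
  assumes "is_coequaliser f g Q q" "k \<in> Arr C" "l \<in> Arr C" "Dom C k = Q" "Dom C l = Q"
    "Cod C k = Cod C l" "k \<cdot> q = l \<cdot> q"
  shows "k = l"
proof -
  note q = coequaliser_simps[OF assms(1)]
  have "(k \<cdot> q) \<cdot> f = (k \<cdot> q) \<cdot> g"
    using q assms by simp
  moreover have "k \<cdot> q \<in> hom C (Cod C f) (Cod C k)"
    using q assms by (simp add: in_hom_iff)
  ultimately have "\<exists>!h. h \<in> hom C Q (Cod C k) \<and> h \<cdot> q = k \<cdot> q"
    using assms(1) unfolding is_coequaliser_def by blast
  then show ?thesis
    using assms by (auto simp: in_hom_iff)
qed

lemma coequaliserI:
  assumes "f \<in> Arr C" "g \<in> Arr C" "Dom C f = Dom C g" "Cod C f = Cod C g"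
    "q \<in> Arr C" "Dom C q = Cod C f" "Cod C q = Q" "q \<cdot> f = q \<cdot> g"
    and factor: "\<And>k. \<lbrakk>k \<in> Arr C; Dom C k = Cod C f; k \<cdot> f = k \<cdot> g\<rbrakk>
      \<Longrightarrow> \<exists>h. h \<in> Arr C \<and> Dom C h = Q \<and> Cod C h = Cod C k \<and> h \<cdot> q = k"
    and epi: "\<And>k l. \<lbrakk>k \<in> Arr C; l \<in> Arr C; Dom C k = Q; Dom C l = Q;
      Cod C k = Cod C l; k \<cdot> q = l \<cdot> q\<rbrakk> \<Longrightarrow> k = l"
  shows "is_coequaliser f g Q q"
  unfolding is_coequaliser_def parallel_def in_hom_iff
proof (intro conjI allI impI)
  fix Z k
  assume k: "(k \<in> Arr C \<and> Dom C k = Cod C f \<and> Cod C k = Z) \<and> k \<cdot> f = k \<cdot> g"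
  then obtain h where "h \<in> Arr C" "Dom C h = Q" "Cod C h = Z" "h \<cdot> q = k"
    using factor by blast
  then show "\<exists>!h. (h \<in> Arr C \<and> Dom C h = Q \<and> Cod C h = Z) \<and> h \<cdot> q = k"
    using epi by (intro ex1I[of _ h]) auto
qed (use assms in auto)

lemma regular_epiE:
  assumes "is_regular_epi e"
  obtains f g where "is_coequaliser f g (Cod C e) e"
  using assms unfolding is_regular_epi_def by blast

lemma regular_epi_epi:
  assumes "is_regular_epi e" "k \<in> Arr C" "l \<in> Arr C" "Dom C k = Cod C e" "Dom C l = Cod C e"
    "Cod C k = Cod C l" "k \<cdot> e = l \<cdot> e"
  shows "k = l"
proof -
  obtain f g where "is_coequaliser f g (Cod C e) e"
    using assms(1) by (rule regular_epiE)
  then show ?thesis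
    by (rule coequaliser_epi) (fact assms)+
qed

text \<open>Precomposing a pair with an epimorphism changes neither the arrows that coequalise it
  nor, therefore, its coequaliser. This lets the image of \<open>G \<otimes> X\<close> in \<open>X \<otimes> X\<close> replace
  \<open>G \<otimes> X\<close> itself in the construction of the quotient.\<close>

lemma coequaliser_precomp_regular_epi:
  assumes p: "is_regular_epi p" "p \<in> Arr C"
    and r: "r1 \<in> Arr C" "r2 \<in> Arr C" "Dom C r1 = Cod C p" "Dom C r2 = Cod C p" "Cod C r1 = Cod C r2"
  shows "is_coequaliser (r1 \<cdot> p) (r2 \<cdot> p) Q q \<longleftrightarrow> is_coequaliser r1 r2 Q q"
proof -
  have "k \<cdot> (r1 \<cdot> p) = k \<cdot> (r2 \<cdot> p) \<longleftrightarrow> k \<cdot> r1 = k \<cdot> r2"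
    if "k \<in> Arr C" "Dom C k = Cod C r1" for k
  proof
    assume "k \<cdot> (r1 \<cdot> p) = k \<cdot> (r2 \<cdot> p)"
    then show "k \<cdot> r1 = k \<cdot> r2"
      using that p(2) r regular_epi_epi[OF p(1), of "k \<cdot> r1" "k \<cdot> r2"] by simp
  next
    assume "k \<cdot> r1 = k \<cdot> r2"
    then have "(k \<cdot> r1) \<cdot> p = (k \<cdot> r2) \<cdot> p"
      by simp
    then show "k \<cdot> (r1 \<cdot> p) = k \<cdot> (r2 \<cdot> p)"
      using that p r by simp
  qed
  then have coequalises: "k \<in> hom C (Cod C (r1 \<cdot> p)) Z \<and> k \<cdot> (r1 \<cdot> p) = k \<cdot> (r2 \<cdot> p) \<longleftrightarrow>
      k \<in> hom C (Cod C r1) Z \<and> k \<cdot> r1 = k \<cdot> r2" for k Z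
    using p r by (auto simp: in_hom_iff)
  have "parallel (r1 \<cdot> p) (r2 \<cdot> p)" "parallel r1 r2"
    using p r by (simp_all add: parallel_def)
  then show ?thesis
    unfolding is_coequaliser_def coequalises using coequalises[of q Q] by blast
qed

text \<open>Two coequalisers of the same pair factor through each other, hence identify the same pairs
  of arrows; so being the kernel pair of one of them is the same as being the kernel pair of the
  other.\<close>

lemma effective_kernel_pair:
  assumes q: "is_coequaliser r1 r2 Q q" and q': "is_coequaliser r1 r2 Q' q'"
    and ker: "is_kernel_pair q' R r1 r2"
  shows "is_kernel_pair q R r1 r2"
proof -
  note [simp] = coequaliser_simps(1-7)[OF q] coequaliser_simps(5-7)[OF q']
  obtain h where h: "h \<in> Arr C" "Dom C h = Q" "Cod C h = Q'" "h \<cdot> q = q'"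
    using coequaliser_factor[OF q, of q'] coequaliser_simps[OF q'] by auto
  have same: "q' \<cdot> k = q' \<cdot> l"
    if "k \<in> Arr C" "l \<in> Arr C" "Cod C k = Cod C r1" "Cod C l = Cod C r1" "q \<cdot> k = q \<cdot> l" for k l
  proof -
    have "(h \<cdot> q) \<cdot> k = (h \<cdot> q) \<cdot> l"
      using that h(1-3) by simp
    then show ?thesis
      by (simp only: h(4))
  qed
  have "\<exists>!h. h \<in> hom C Z R \<and> r1 \<cdot> h = k \<and> r2 \<cdot> h = l"
    if "k \<in> hom C Z (Dom C q) \<and> l \<in> hom C Z (Dom C q) \<and> q \<cdot> k = q \<cdot> l" for Z k l
  proof -
    have kl: "k \<in> hom C Z (Dom C q') \<and> l \<in> hom C Z (Dom C q') \<and> q' \<cdot> k = q' \<cdot> l"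
      using that same[of k l] by (simp add: in_hom_iff)
    then show ?thesis
      using ker unfolding is_kernel_pair_def is_pullback_def by blast
  qed
  moreover have "Dom C r1 = R"
    using ker pullback_simps(5) unfolding is_kernel_pair_def by blast
  ultimately show ?thesis
    unfolding is_kernel_pair_def is_pullback_def
    using coequaliser_simps[OF q] by (simp add: in_hom_iff)
qed

end

section \<open>Finite limits and the calculus of generalised elements\<close>

text \<open>The arrows \<open>0\<close>, \<open>1\<close>, \<open>2\<close> are the identities, and \<open>3 : 0 \<rightarrow> 2\<close> and \<open>4 : 1 \<rightarrow> 2\<close> form the cospan.\<close>

definition cospan :: "(nat, nat) cat" where
  "cospan = \<lparr>Obj = {0, 1, 2}, Arr = {0, 1, 2, 3, 4},
     Dom = (\<lambda>u. if u < 3 then u else u - 3), Cod = (\<lambda>u. if u < 3 then u else 2),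
     Id = (\<lambda>i. i), Comp = (\<lambda>v u. if v < 3 then u else v)\<rparr>"

lemma category_cospan: "category cospan"
  by unfold_locales (auto simp: cospan_def hom_def)

definition empty_shape :: "(nat, nat) cat" where
  "empty_shape = \<lparr>Obj = {}, Arr = {}, Dom = id, Cod = id, Id = id, Comp = (\<lambda>v u. u)\<rparr>"

lemma category_empty_shape: "category empty_shape"
  by unfold_locales (auto simp: empty_shape_def hom_def)

context finitely_complete_category
begin

lemma terminal_exists: "\<exists>T. is_terminal T"
proof -
  have "is_functor empty_shape C F H" for F H
    by (simp add: is_functor_def empty_shape_def)
  then obtain L p where "is_limit empty_shape C (\<lambda>_. undefined) (\<lambda>_. undefined) L p"
    using finite_limits category_empty_shape unfolding has_finite_limits_def
    by (metis (no_types, lifting) cat.select_convs(1,2) empty_shape_def finite.emptyI)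
  then show ?thesis
    unfolding is_limit_def is_cone_def is_terminal_def
    by (simp add: empty_shape_def) blast
qed

lemma pullback_exists:
  assumes f: "f \<in> Arr C" and g: "g \<in> Arr C" and fg: "Cod C f = Cod C g"
  shows "\<exists>P p1 p2. is_pullback f g P p1 p2"
proof -
  define Fo where "Fo i = (if i = 0 then Dom C f else if i = 1 then Dom C g else Cod C f)" for i :: nat
  define Fa where "Fa u = (if u = 3 then f else if u = 4 then g else Id C (Fo u))" for u :: nat
  have "is_functor cospan C Fo Fa"
    using assms by (auto simp: is_functor_def cospan_def Fo_def Fa_def in_hom_iff)
  moreover have "finite (Obj cospan)" "finite (Arr cospan)"
    by (simp_all add: cospan_def)
  ultimately obtain L p where "is_limit cospan C Fo Fa L p"
    using finite_limits category_cospan unfolding has_finite_limits_def by blast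
  then have cone: "is_cone cospan C Fo Fa L p"
    and univ: "\<And>M r. is_cone cospan C Fo Fa M r \<Longrightarrow>
      \<exists>!h. h \<in> hom C M L \<and> (\<forall>i \<in> {0, 1, 2}. p i \<cdot> h = r i)"
    unfolding is_limit_def by (simp_all add: cospan_def)
  have p: "p 0 \<in> Arr C" "Dom C (p 0) = L" "Cod C (p 0) = Dom C f"
    "p 1 \<in> Arr C" "Dom C (p 1) = L" "Cod C (p 1) = Dom C g" "p 2 = f \<cdot> p 0" "f \<cdot> p 0 = g \<cdot> p 1"
    using cone fg by (auto simp: is_cone_def cospan_def Fo_def Fa_def in_hom_iff)
  have "is_pullback f g L (p 0) (p 1)"
    unfolding is_pullback_def
  proof (intro conjI allI impI)
    fix Z k l
    assume kl: "k \<in> hom C Z (Dom C f) \<and> l \<in> hom C Z (Dom C g) \<and> f \<cdot> k = g \<cdot> l"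
    define r where "r i = (if i = 0 then k else if i = 1 then l else f \<cdot> k)" for i :: nat
    have "is_cone cospan C Fo Fa Z r"
      using kl assms by (auto simp: is_cone_def cospan_def Fo_def Fa_def r_def in_hom_iff)
    then have "\<exists>!h. h \<in> hom C Z L \<and> (\<forall>i \<in> {0, 1, 2}. p i \<cdot> h = r i)"
      by (rule univ)
    moreover have "p 2 \<cdot> h = f \<cdot> k" if "h \<in> hom C Z L" "p 0 \<cdot> h = k" for h
    proof -
      have "(f \<cdot> p 0) \<cdot> h = f \<cdot> (p 0 \<cdot> h)"
        by (rule Comp_assoc_right) (use that(1) p(1-3) f in \<open>simp_all add: in_hom_iff\<close>)
      then show ?thesis
        by (simp only: p(7) that(2))
    qed
    then have "h \<in> hom C Z L \<and> (\<forall>i \<in> {0, 1, 2}. p i \<cdot> h = r i) \<longleftrightarrow>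
        h \<in> hom C Z L \<and> p 0 \<cdot> h = k \<and> p 1 \<cdot> h = l" for h
      by (auto simp: r_def)
    ultimately show "\<exists>!h. h \<in> hom C Z L \<and> p 0 \<cdot> h = k \<and> p 1 \<cdot> h = l"
      by simp
  qed (use p assms in \<open>simp_all add: in_hom_iff\<close>)
  then show ?thesis
    by blast
qed

lemma is_terminal_terminal_obj: "is_terminal \<one>"
  unfolding terminal_obj_def using terminal_exists by (rule someI_ex)

lemma terminal_obj_in_Obj [simp]: "\<one> \<in> Obj C"
  using is_terminal_terminal_obj unfolding is_terminal_def by blast

lemma terminal_unique:
  assumes "f \<in> Arr C" "g \<in> Arr C" "Dom C f = Dom C g" "Cod C f = \<one>" "Cod C g = \<one>"
  shows "f = g"
  using assms is_terminal_terminal_obj Dom_in_Obj unfolding is_terminal_def in_hom_iff by metis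

lemma bang_simps [simp]:
  assumes "A \<in> Obj C"
  shows "bang A \<in> Arr C" "Dom C (bang A) = A" "Cod C (bang A) = \<one>"
proof -
  have "\<exists>!f. f \<in> hom C A \<one>"
    using assms is_terminal_terminal_obj unfolding is_terminal_def by blast
  then have "bang A \<in> hom C A \<one>"
    unfolding bang_def by (rule theI')
  then show "bang A \<in> Arr C" "Dom C (bang A) = A" "Cod C (bang A) = \<one>"
    by (simp_all add: in_hom_iff)
qed

lemma bang_Comp [simp]: "f \<in> Arr C \<Longrightarrow> Cod C f = A \<Longrightarrow> bang A \<cdot> f = bang (Dom C f)"
  by (rule terminal_unique) auto

text \<open>A product is a pullback over the terminal object.\<close>

lemma product_exists:
  assumes "A \<in> Obj C" "B \<in> Obj C"
  shows "\<exists>P p1 p2. is_product A B P p1 p2"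
proof -
  obtain P p1 p2 where P: "is_pullback (bang A) (bang B) P p1 p2"
    using pullback_exists[of "bang A" "bang B"] assms by auto
  have "\<exists>!h. h \<in> hom C Z P \<and> p1 \<cdot> h = k \<and> p2 \<cdot> h = l"
    if "k \<in> hom C Z A \<and> l \<in> hom C Z B" for Z k l
  proof -
    have "k \<in> hom C Z (Dom C (bang A)) \<and> l \<in> hom C Z (Dom C (bang B)) \<and> bang A \<cdot> k = bang B \<cdot> l"
      using that assms by (simp add: in_hom_iff)
    then show ?thesis
      using P unfolding is_pullback_def by blast
  qed
  then have "is_product A B P p1 p2"
    using assms pullback_simps[OF P] by (simp add: is_product_def in_hom_iff)
  then show ?thesis
    by blast
qed

lemma is_product_product_obj:
  assumes "A \<in> Obj C" "B \<in> Obj C"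
  shows "is_product A B (A \<otimes> B) (pr1 A B) (pr2 A B)"
proof -
  have "\<exists>z. case z of (P, p1, p2) \<Rightarrow> is_product A B P p1 p2"
    using product_exists[OF assms] by auto
  then have "case product_cone A B of (P, p1, p2) \<Rightarrow> is_product A B P p1 p2"
    unfolding product_cone_def by (rule someI_ex)
  then show ?thesis
    by (simp add: product_obj_def pr1_def pr2_def split: prod.splits)
qed

lemma pr_simps [simp]:
  assumes "A \<in> Obj C" "B \<in> Obj C"
  shows "pr1 A B \<in> Arr C" "Dom C (pr1 A B) = A \<otimes> B" "Cod C (pr1 A B) = A"
    "pr2 A B \<in> Arr C" "Dom C (pr2 A B) = A \<otimes> B" "Cod C (pr2 A B) = B"
  using is_product_product_obj[OF assms] unfolding is_product_def in_hom_iff by auto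

lemma product_in_Obj [simp]: "A \<in> Obj C \<Longrightarrow> B \<in> Obj C \<Longrightarrow> A \<otimes> B \<in> Obj C"
  using Dom_in_Obj[of "pr1 A B"] by simp

lemma pairing_props:
  assumes "f \<in> Arr C" "g \<in> Arr C" "Dom C f = Dom C g"
  shows "\<langle>f, g\<rangle> \<in> hom C (Dom C f) (Cod C f \<otimes> Cod C g) \<and>
     pr1 (Cod C f) (Cod C g) \<cdot> \<langle>f, g\<rangle> = f \<and> pr2 (Cod C f) (Cod C g) \<cdot> \<langle>f, g\<rangle> = g"
proof -
  have "\<exists>!h. h \<in> hom C (Dom C f) (Cod C f \<otimes> Cod C g) \<and>
     pr1 (Cod C f) (Cod C g) \<cdot> h = f \<and> pr2 (Cod C f) (Cod C g) \<cdot> h = g"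
  proof -
    have "f \<in> hom C (Dom C f) (Cod C f) \<and> g \<in> hom C (Dom C f) (Cod C g)"
      using assms by (simp add: in_hom_iff)
    then show ?thesis
      using is_product_product_obj[of "Cod C f" "Cod C g"] assms Cod_in_Obj
      unfolding is_product_def by blast
  qed
  then show ?thesis
    unfolding pairing_def by (rule theI')
qed

lemma pairing_simps [simp]:
  assumes "f \<in> Arr C" "g \<in> Arr C" "Dom C f = Dom C g"
  shows "\<langle>f, g\<rangle> \<in> Arr C" "Dom C \<langle>f, g\<rangle> = Dom C g" "Cod C \<langle>f, g\<rangle> = Cod C f \<otimes> Cod C g"
  using pairing_props[OF assms] assms by (simp_all add: in_hom_iff)

lemma pr_pairing [simp]:
  assumes "f \<in> Arr C" "g \<in> Arr C" "Dom C f = Dom C g" "Cod C f = A" "Cod C g = B"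
  shows "pr1 A B \<cdot> \<langle>f, g\<rangle> = f" "pr2 A B \<cdot> \<langle>f, g\<rangle> = g"
  using pairing_props[OF assms(1-3)] assms by auto

lemma product_arr_eqI:
  assumes "A \<in> Obj C" "B \<in> Obj C" "h \<in> Arr C" "k \<in> Arr C" "Dom C h = Dom C k"
    "Cod C h = A \<otimes> B" "Cod C k = A \<otimes> B"
    "pr1 A B \<cdot> h = pr1 A B \<cdot> k" "pr2 A B \<cdot> h = pr2 A B \<cdot> k"
  shows "h = k"
proof -
  have "pr1 A B \<cdot> k \<in> hom C (Dom C k) A" "pr2 A B \<cdot> k \<in> hom C (Dom C k) B"
    using assms by (simp_all add: in_hom_iff)
  then have "\<exists>!h. h \<in> hom C (Dom C k) (A \<otimes> B) \<and>
      pr1 A B \<cdot> h = pr1 A B \<cdot> k \<and> pr2 A B \<cdot> h = pr2 A B \<cdot> k"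
    using is_product_product_obj[OF assms(1,2)] unfolding is_product_def by blast
  then show ?thesis
    using assms by (auto simp: in_hom_iff)
qed

lemma pairing_Comp [simp]:
  assumes "f \<in> Arr C" "g \<in> Arr C" "h \<in> Arr C" "Dom C f = Cod C h" "Dom C g = Cod C h"
  shows "\<langle>f, g\<rangle> \<cdot> h = \<langle>f \<cdot> h, g \<cdot> h\<rangle>"
proof (rule product_arr_eqI[of "Cod C f" "Cod C g"])
  have "pr1 (Cod C f) (Cod C g) \<cdot> (\<langle>f, g\<rangle> \<cdot> h) = (pr1 (Cod C f) (Cod C g) \<cdot> \<langle>f, g\<rangle>) \<cdot> h"
    by (rule Comp_assoc_right[symmetric]) (use assms in simp_all)
  then show "pr1 (Cod C f) (Cod C g) \<cdot> (\<langle>f, g\<rangle> \<cdot> h)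
      = pr1 (Cod C f) (Cod C g) \<cdot> \<langle>f \<cdot> h, g \<cdot> h\<rangle>"
    using assms by simp
  have "pr2 (Cod C f) (Cod C g) \<cdot> (\<langle>f, g\<rangle> \<cdot> h) = (pr2 (Cod C f) (Cod C g) \<cdot> \<langle>f, g\<rangle>) \<cdot> h"
    by (rule Comp_assoc_right[symmetric]) (use assms in simp_all)
  then show "pr2 (Cod C f) (Cod C g) \<cdot> (\<langle>f, g\<rangle> \<cdot> h)
      = pr2 (Cod C f) (Cod C g) \<cdot> \<langle>f \<cdot> h, g \<cdot> h\<rangle>"
    using assms by simp
qed (use assms in simp_all)

lemma pairing_eta:
  assumes "A \<in> Obj C" "B \<in> Obj C" "h \<in> Arr C" "Cod C h = A \<otimes> B"
  shows "\<langle>pr1 A B \<cdot> h, pr2 A B \<cdot> h\<rangle> = h"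
  by (rule product_arr_eqI[of A B]) (use assms in simp_all)

lemma product_map_simps [simp]:
  assumes "f \<in> Arr C" "g \<in> Arr C"
  shows "f \<otimes>\<^sub>m g \<in> Arr C" "Dom C (f \<otimes>\<^sub>m g) = Dom C f \<otimes> Dom C g"
    "Cod C (f \<otimes>\<^sub>m g) = Cod C f \<otimes> Cod C g"
  using assms by (simp_all add: product_map_def)

lemma product_map_pairing [simp]:
  assumes "f \<in> Arr C" "g \<in> Arr C" "h \<in> Arr C" "k \<in> Arr C" "Dom C h = Dom C k"
    "Cod C h = Dom C f" "Cod C k = Dom C g"
  shows "(f \<otimes>\<^sub>m g) \<cdot> \<langle>h, k\<rangle> = \<langle>f \<cdot> h, g \<cdot> k\<rangle>"
  using assms by (simp add: product_map_def)

lemma assoc_simps [simp]: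
  assumes "A \<in> Obj C" "B \<in> Obj C" "D \<in> Obj C"
  shows "assoc A B D \<in> Arr C" "Dom C (assoc A B D) = A \<otimes> B \<otimes> D"
    "Cod C (assoc A B D) = (A \<otimes> B) \<otimes> D"
  using assms by (simp_all add: assoc_def)

lemma assoc_pairing [simp]:
  assumes "f \<in> Arr C" "g \<in> Arr C" "h \<in> Arr C" "Dom C f = Dom C h" "Dom C g = Dom C h"
    "Cod C f = A" "Cod C g = B" "Cod C h = D"
  shows "assoc A B D \<cdot> \<langle>f, \<langle>g, h\<rangle>\<rangle> = \<langle>\<langle>f, g\<rangle>, h\<rangle>"
  using assms by (auto simp: assoc_def)

end

section \<open>Images in a regular category\<close>

context regular_category
begin

text \<open>The image is the coequaliser of the kernel pair. The remaining factor \<open>j\<close> is monic because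
  two arrows \<open>k\<close>, \<open>l\<close> into the image lift along \<open>p\<close> after passing to a cover of their domain;
  if \<open>j \<cdot> k = j \<cdot> l\<close>, the lifts form an element of the kernel pair, so \<open>k\<close> and \<open>l\<close> agree on the
  cover.\<close>

lemma image_factorisation_exists:
  assumes f: "f \<in> Arr C"
  shows "\<exists>R p j. is_image_factorisation f R p j"
proof -
  obtain K k1 k2 where K: "is_pullback f f K k1 k2"
    using pullback_exists[OF f f] by blast
  then obtain R p where p: "is_coequaliser k1 k2 R p"
    using kernel_pair_coequaliser unfolding is_kernel_pair_def by blast
  note [simp] = f pullback_simps(4-9)[OF K] coequaliser_simps(5-7)[OF p]
  obtain j where j [simp]: "j \<in> Arr C" "Dom C j = R" "Cod C j = Cod C f" and jp: "j \<cdot> p = f"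
    using coequaliser_factor[OF p f] pullback_simps[OF K] by auto
  have p_epi: "is_regular_epi p"
    unfolding is_regular_epi_def using p by auto
  have "k = l"
    if kl [simp]: "k \<in> Arr C" "l \<in> Arr C" "Dom C k = Z" "Dom C l = Z" "Cod C k = R" "Cod C l = R"
      and eq: "j \<cdot> k = j \<cdot> l" for Z k l
  proof -
    \<comment> \<open>On the cover \<open>e1 \<cdot> e2\<close> of \<open>Z\<close>, the arrows \<open>k\<close> and \<open>l\<close> lift to \<open>a1 \<cdot> e2\<close> and \<open>a2\<close>.\<close>
    obtain P1 a1 e1 where P1: "is_pullback p k P1 a1 e1"
      using pullback_exists[of p k] by auto
    note [simp] = pullback_simps(4-9)[OF P1]
    obtain P2 a2 e2 where P2: "is_pullback p (l \<cdot> e1) P2 a2 e2"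
      using pullback_exists[of p "l \<cdot> e1"] by auto
    note [simp] = pullback_simps(4-6)[OF P2] pullback_simps(7-9)[OF P2, simplified]
    have e1: "is_regular_epi e1" and e2: "is_regular_epi e2"
      using regular_epi_pullback_stable[OF p_epi] P1 P2 by auto
    have pa1: "p \<cdot> (a1 \<cdot> e2) = k \<cdot> (e1 \<cdot> e2)"
      using Comp_assoc_eq[OF pullback_simps(10)[OF P1], of e2] by simp
    have pa2: "p \<cdot> a2 = l \<cdot> (e1 \<cdot> e2)"
      using pullback_simps(10)[OF P2] by simp
    have "f \<cdot> (a1 \<cdot> e2) = j \<cdot> (k \<cdot> (e1 \<cdot> e2))"
      unfolding pa1[symmetric] jp[symmetric] by simp
    also have "\<dots> = j \<cdot> (l \<cdot> (e1 \<cdot> e2))"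
      using Comp_assoc_eq[OF eq, of "e1 \<cdot> e2"] by simp
    also have "\<dots> = f \<cdot> a2"
      unfolding pa2[symmetric] jp[symmetric] by simp
    finally have "f \<cdot> (a1 \<cdot> e2) = f \<cdot> a2" .
    then obtain h where h [simp]: "h \<in> Arr C" "Dom C h = P2" "Cod C h = K"
      and kh: "k1 \<cdot> h = a1 \<cdot> e2" "k2 \<cdot> h = a2"
      using pullback_factor[OF K, of "a1 \<cdot> e2" a2] by auto
    have "p \<cdot> (a1 \<cdot> e2) = p \<cdot> a2"
      unfolding kh[symmetric] using Comp_assoc_eq[OF coequaliser_simps(8)[OF p], of h] by simp
    then have "k \<cdot> (e1 \<cdot> e2) = l \<cdot> (e1 \<cdot> e2)"
      by (simp add: pa1 pa2)
    then have "k \<cdot> e1 = l \<cdot> e1"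
      using regular_epi_epi[OF e2, of "k \<cdot> e1" "l \<cdot> e1"] by simp
    then show ?thesis
      using regular_epi_epi[OF e1, of k l] by simp
  qed
  then have "is_mono j"
    by (simp add: is_mono_def in_hom_iff)
  then have "is_image_factorisation f R p j"
    using p_epi jp by (simp add: is_image_factorisation_def in_hom_iff)
  then show ?thesis
    by blast
qed

end

section \<open>Group actions on generalised elements\<close>

locale group_action = finitely_complete_category C for C :: "('o, 'm) cat" (structure) +
  fixes G m e i X a
  assumes group_object: "is_group_object G m e i"
    and action: "is_action G m e X a"
begin

lemma group_action_simps [simp]:
  "G \<in> Obj C" "X \<in> Obj C"
  "m \<in> Arr C" "Dom C m = G \<otimes> G" "Cod C m = G"
  "e \<in> Arr C" "Dom C e = \<one>" "Cod C e = G"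
  "i \<in> Arr C" "Dom C i = G" "Cod C i = G"
  "a \<in> Arr C" "Dom C a = G \<otimes> X" "Cod C a = X"
  using group_object action unfolding is_group_object_def is_action_def in_hom_iff by auto

lemma inverse_mult:
  assumes "x \<in> Arr C" "Cod C x = G"
  shows "m \<cdot> \<langle>i \<cdot> x, x\<rangle> = e \<cdot> bang (Dom C x)" "m \<cdot> \<langle>x, i \<cdot> x\<rangle> = e \<cdot> bang (Dom C x)"
proof -
  have "m \<cdot> \<langle>i, Id C G\<rangle> = e \<cdot> bang G" "m \<cdot> \<langle>Id C G, i\<rangle> = e \<cdot> bang G"
    using group_object unfolding is_group_object_def by auto
  then have "(m \<cdot> \<langle>i, Id C G\<rangle>) \<cdot> x = (e \<cdot> bang G) \<cdot> x" "(m \<cdot> \<langle>Id C G, i\<rangle>) \<cdot> x = (e \<cdot> bang G) \<cdot> x"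
    by auto
  then show "m \<cdot> \<langle>i \<cdot> x, x\<rangle> = e \<cdot> bang (Dom C x)" "m \<cdot> \<langle>x, i \<cdot> x\<rangle> = e \<cdot> bang (Dom C x)"
    using assms by auto
qed

lemma unit_mult:
  assumes "x \<in> Arr C" "Cod C x = G"
  shows "m \<cdot> \<langle>e \<cdot> bang (Dom C x), x\<rangle> = x"
proof -
  have "m \<cdot> \<langle>e \<cdot> bang G, Id C G\<rangle> = Id C G"
    using group_object unfolding is_group_object_def by auto
  then have "(m \<cdot> \<langle>e \<cdot> bang G, Id C G\<rangle>) \<cdot> x = Id C G \<cdot> x"
    by auto
  then show ?thesis
    using assms by auto
qed

lemma mult_assoc:
  assumes "x \<in> Arr C" "y \<in> Arr C" "z \<in> Arr C" "Cod C x = G" "Cod C y = G" "Cod C z = G"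
    "Dom C x = Dom C z" "Dom C y = Dom C z"
  shows "m \<cdot> \<langle>m \<cdot> \<langle>x, y\<rangle>, z\<rangle> = m \<cdot> \<langle>x, m \<cdot> \<langle>y, z\<rangle>\<rangle>"
proof -
  have "m \<cdot> (m \<otimes>\<^sub>m Id C G) \<cdot> assoc G G G = m \<cdot> (Id C G \<otimes>\<^sub>m m)"
    using group_object unfolding is_group_object_def by auto
  then have "(m \<cdot> (m \<otimes>\<^sub>m Id C G) \<cdot> assoc G G G) \<cdot> \<langle>x, \<langle>y, z\<rangle>\<rangle> = (m \<cdot> (Id C G \<otimes>\<^sub>m m)) \<cdot> \<langle>x, \<langle>y, z\<rangle>\<rangle>"
    by simp
  then show ?thesis
    using assms by simp
qed

lemma mult_inverse_mult:
  assumes "x \<in> Arr C" "y \<in> Arr C" "Cod C x = G" "Cod C y = G" "Dom C x = Dom C y"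
  shows "m \<cdot> \<langle>x, m \<cdot> \<langle>i \<cdot> x, y\<rangle>\<rangle> = y"
  using assms mult_assoc[of x "i \<cdot> x" y] inverse_mult(2)[of x] unit_mult[of y] by simp

lemma act_mult:
  assumes "x \<in> Arr C" "y \<in> Arr C" "z \<in> Arr C" "Cod C x = G" "Cod C y = G" "Cod C z = X"
    "Dom C x = Dom C z" "Dom C y = Dom C z"
  shows "a \<cdot> \<langle>m \<cdot> \<langle>x, y\<rangle>, z\<rangle> = a \<cdot> \<langle>x, a \<cdot> \<langle>y, z\<rangle>\<rangle>"
proof -
  have "a \<cdot> (m \<otimes>\<^sub>m Id C X) \<cdot> assoc G G X = a \<cdot> (Id C G \<otimes>\<^sub>m a)"
    using action unfolding is_action_def by auto
  then have "(a \<cdot> (m \<otimes>\<^sub>m Id C X) \<cdot> assoc G G X) \<cdot> \<langle>x, \<langle>y, z\<rangle>\<rangle> = (a \<cdot> (Id C G \<otimes>\<^sub>m a)) \<cdot> \<langle>x, \<langle>y, z\<rangle>\<rangle>"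
    by simp
  then show ?thesis
    using assms by simp
qed

lemma act_unit:
  assumes "z \<in> Arr C" "Cod C z = X"
  shows "a \<cdot> \<langle>e \<cdot> bang (Dom C z), z\<rangle> = z"
proof -
  have "a \<cdot> \<langle>e \<cdot> bang X, Id C X\<rangle> = Id C X"
    using action unfolding is_action_def by auto
  then have "(a \<cdot> \<langle>e \<cdot> bang X, Id C X\<rangle>) \<cdot> z = Id C X \<cdot> z"
    by auto
  then show ?thesis
    using assms by auto
qed

lemma act_inverse_act:
  assumes "x \<in> Arr C" "z \<in> Arr C" "Cod C x = G" "Cod C z = X" "Dom C x = Dom C z"
  shows "a \<cdot> \<langle>i \<cdot> x, a \<cdot> \<langle>x, z\<rangle>\<rangle> = z"
  using assms act_mult[of "i \<cdot> x" x z] inverse_mult(1)[of x] act_unit[of z] by simp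

lemma quotient_simps:
  assumes "is_quotient G X a Q q"
  shows "q \<in> Arr C" "Dom C q = X" "Cod C q = Q" "Q \<in> Obj C"
  using coequaliser_simps[OF assms[unfolded is_quotient_def]] Cod_in_Obj[of q] by auto

lemma quotient_act:
  assumes q: "is_quotient G X a Q q"
    and xz: "x \<in> Arr C" "z \<in> Arr C" "Cod C x = G" "Cod C z = X" "Dom C x = Dom C z"
  shows "q \<cdot> (a \<cdot> \<langle>x, z\<rangle>) = q \<cdot> z"
proof -
  have "(q \<cdot> a) \<cdot> \<langle>x, z\<rangle> = (q \<cdot> pr2 G X) \<cdot> \<langle>x, z\<rangle>"
    using coequaliser_simps(8)[OF q[unfolded is_quotient_def]] by simp
  then show ?thesis
    using xz quotient_simps[OF q] by simp
qed

lemma section_simps: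
  assumes "is_quotient G X a Q q" "is_section q s"
  shows "s \<in> Arr C" "Dom C s = Q" "Cod C s = X" "q \<cdot> s = Id C Q"
  using assms(2) quotient_simps[OF assms(1)] by (auto simp: is_section_def in_hom_iff)

lemma section_right_inverse:
  assumes "is_quotient G X a Q q" "is_section q s" "y \<in> Arr C" "Cod C y = Q"
  shows "q \<cdot> (s \<cdot> y) = y"
  using Comp_assoc_eq[OF section_simps(4)[OF assms(1,2)], of y]
    section_simps[OF assms(1,2)] quotient_simps[OF assms(1)] assms by simp

lemma orbit_map_pairing:
  assumes "is_quotient G X a Q q" "is_section q s"
    "x \<in> Arr C" "y \<in> Arr C" "Cod C x = G" "Cod C y = Q" "Dom C x = Dom C y"
  shows "(a \<cdot> (Id C G \<otimes>\<^sub>m s)) \<cdot> \<langle>x, y\<rangle> = a \<cdot> \<langle>x, s \<cdot> y\<rangle>"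
  using assms section_simps[OF assms(1,2)] by simp

section \<open>The stabiliser presents the orbit map\<close>

text \<open>A generalised element of \<open>P\<close> amounts to a class \<open>y = u \<cdot> w\<close> and a stabilising element \<open>h\<close> of its
  representative \<open>s(y)\<close>, where \<open>h\<close> is the \<open>G\<close>-component of \<open>\<iota> \<cdot> v \<cdot> w\<close>. In these terms the stabiliser
  pair sends \<open>(x, w)\<close> to \<open>(x, y)\<close> and \<open>(x h, y)\<close>.\<close>

lemma stabiliser_pair_pairing:
  assumes q: "is_quotient G X a Q q" and s: "is_section q s"
    and S: "is_stabiliser G X a S \<iota>" and P: "is_pullback s (pr2 G X \<cdot> \<iota>) P u v"
    and xw: "x \<in> Arr C" "w \<in> Arr C" "Cod C x = G" "Cod C w = P" "Dom C x = Dom C w"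
  shows "(Id C G \<otimes>\<^sub>m u) \<cdot> \<langle>x, w\<rangle> = \<langle>x, u \<cdot> w\<rangle>"
    "((m \<otimes>\<^sub>m q) \<cdot> assoc G G X \<cdot> (Id C G \<otimes>\<^sub>m \<iota>) \<cdot> (Id C G \<otimes>\<^sub>m v)) \<cdot> \<langle>x, w\<rangle>
      = \<langle>m \<cdot> \<langle>x, pr1 G X \<cdot> (\<iota> \<cdot> (v \<cdot> w))\<rangle>, u \<cdot> w\<rangle>"
    "pr2 G X \<cdot> (\<iota> \<cdot> (v \<cdot> w)) = s \<cdot> (u \<cdot> w)"
    "a \<cdot> (\<iota> \<cdot> (v \<cdot> w)) = s \<cdot> (u \<cdot> w)"
proof -
  note [simp] = quotient_simps[OF q] section_simps(1-3)[OF q s] xw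
  have [simp]: "\<iota> \<in> Arr C" "Dom C \<iota> = S" "Cod C \<iota> = G \<otimes> X"
    and \<iota>: "a \<cdot> \<iota> = pr2 G X \<cdot> \<iota>"
    using S by (auto simp: is_stabiliser_def is_equaliser_def in_hom_iff)
  note [simp] = pullback_simps(4-9)[OF P, simplified]
  show "(Id C G \<otimes>\<^sub>m u) \<cdot> \<langle>x, w\<rangle> = \<langle>x, u \<cdot> w\<rangle>"
    by simp
  have "(s \<cdot> u) \<cdot> w = ((pr2 G X \<cdot> \<iota>) \<cdot> v) \<cdot> w"
    by (simp only: pullback_simps(10)[OF P])
  then show 2: "pr2 G X \<cdot> (\<iota> \<cdot> (v \<cdot> w)) = s \<cdot> (u \<cdot> w)"
    by simp
  have "(a \<cdot> \<iota>) \<cdot> (v \<cdot> w) = (pr2 G X \<cdot> \<iota>) \<cdot> (v \<cdot> w)"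
    by (simp only: \<iota>)
  then show "a \<cdot> (\<iota> \<cdot> (v \<cdot> w)) = s \<cdot> (u \<cdot> w)"
    using 2 by simp
  define h where "h = pr1 G X \<cdot> (\<iota> \<cdot> (v \<cdot> w))"
  have [simp]: "h \<in> Arr C" "Dom C h = Dom C w" "Cod C h = G"
    by (simp_all add: h_def)
  have "\<iota> \<cdot> (v \<cdot> w) = \<langle>h, s \<cdot> (u \<cdot> w)\<rangle>"
    using pairing_eta[of G X "\<iota> \<cdot> (v \<cdot> w)"] 2 by (simp add: h_def)
  then have "((m \<otimes>\<^sub>m q) \<cdot> assoc G G X \<cdot> (Id C G \<otimes>\<^sub>m \<iota>) \<cdot> (Id C G \<otimes>\<^sub>m v)) \<cdot> \<langle>x, w\<rangle>
      = \<langle>m \<cdot> \<langle>x, h\<rangle>, q \<cdot> (s \<cdot> (u \<cdot> w))\<rangle>"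
    by simp
  then show "((m \<otimes>\<^sub>m q) \<cdot> assoc G G X \<cdot> (Id C G \<otimes>\<^sub>m \<iota>) \<cdot> (Id C G \<otimes>\<^sub>m v)) \<cdot> \<langle>x, w\<rangle>
      = \<langle>m \<cdot> \<langle>x, pr1 G X \<cdot> (\<iota> \<cdot> (v \<cdot> w))\<rangle>, u \<cdot> w\<rangle>"
    using section_right_inverse[OF q s, of "u \<cdot> w"] by (simp add: h_def)
qed

text \<open>If \<open>x s(y) = x' s(y')\<close>, then applying \<open>q\<close> gives \<open>y = y'\<close>, and \<open>x\<inverse> x'\<close> fixes \<open>s(y)\<close>. So the
  pair \<open>(x, y)\<close>, \<open>(x', y')\<close> is the image of \<open>(x, (x\<inverse> x', s(y)))\<close> under the stabiliser pair.\<close>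

lemma orbit_map_eq_factor:
  assumes q: "is_quotient G X a Q q" and s: "is_section q s"
    and S: "is_stabiliser G X a S \<iota>" and P: "is_pullback s (pr2 G X \<cdot> \<iota>) P u v"
    and \<alpha>\<beta>: "\<alpha> \<in> Arr C" "\<beta> \<in> Arr C" "Dom C \<alpha> = Dom C \<beta>" "Cod C \<alpha> = G \<otimes> Q" "Cod C \<beta> = G \<otimes> Q"
    and eq: "(a \<cdot> (Id C G \<otimes>\<^sub>m s)) \<cdot> \<alpha> = (a \<cdot> (Id C G \<otimes>\<^sub>m s)) \<cdot> \<beta>"
  obtains t where "t \<in> Arr C" "Dom C t = Dom C \<beta>" "Cod C t = G \<otimes> P"
    "(Id C G \<otimes>\<^sub>m u) \<cdot> t = \<alpha>"
    "((m \<otimes>\<^sub>m q) \<cdot> assoc G G X \<cdot> (Id C G \<otimes>\<^sub>m \<iota>) \<cdot> (Id C G \<otimes>\<^sub>m v)) \<cdot> t = \<beta>"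
proof -
  note [simp] = quotient_simps[OF q] section_simps(1-3)[OF q s] \<alpha>\<beta>
  have [simp]: "\<iota> \<in> Arr C" "Dom C \<iota> = S" "Cod C \<iota> = G \<otimes> X"
    using S by (auto simp: is_stabiliser_def is_equaliser_def in_hom_iff)
  note [simp] = pullback_simps(4-9)[OF P, simplified]
  define Z where "Z = Dom C \<beta>"
  define x where "x = pr1 G Q \<cdot> \<alpha>"
  define y where "y = pr2 G Q \<cdot> \<alpha>"
  define x' where "x' = pr1 G Q \<cdot> \<beta>"
  define y' where "y' = pr2 G Q \<cdot> \<beta>"
  have [simp]: "x \<in> Arr C" "Dom C x = Z" "Cod C x = G" "y \<in> Arr C" "Dom C y = Z" "Cod C y = Q"
    "x' \<in> Arr C" "Dom C x' = Z" "Cod C x' = G" "y' \<in> Arr C" "Dom C y' = Z" "Cod C y' = Q"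
    by (simp_all add: x_def y_def x'_def y'_def Z_def)
  have \<alpha>: "\<alpha> = \<langle>x, y\<rangle>" and \<beta>: "\<beta> = \<langle>x', y'\<rangle>"
    using pairing_eta[of G Q \<alpha>] pairing_eta[of G Q \<beta>] by (simp_all add: x_def y_def x'_def y'_def)
  have orbit_eq: "a \<cdot> \<langle>x, s \<cdot> y\<rangle> = a \<cdot> \<langle>x', s \<cdot> y'\<rangle>"
    using eq unfolding \<alpha> \<beta> by (simp add: orbit_map_pairing[OF q s] del: Comp_assoc_right)
  have "y = q \<cdot> (a \<cdot> \<langle>x, s \<cdot> y\<rangle>)"
    by (simp add: quotient_act[OF q] section_right_inverse[OF q s])
  also have "\<dots> = y'"
    unfolding orbit_eq by (simp add: quotient_act[OF q] section_right_inverse[OF q s])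
  finally have y': "y' = y" ..
  \<comment> \<open>The element \<open>x\<inverse> x'\<close> of the stabiliser of \<open>s(y)\<close>.\<close>
  define h where "h = m \<cdot> \<langle>i \<cdot> x, x'\<rangle>"
  have [simp]: "h \<in> Arr C" "Dom C h = Z" "Cod C h = G"
    by (simp_all add: h_def)
  have xh: "m \<cdot> \<langle>x, h\<rangle> = x'"
    by (simp add: h_def mult_inverse_mult)
  have "a \<cdot> \<langle>h, s \<cdot> y\<rangle> = a \<cdot> \<langle>i \<cdot> x, a \<cdot> \<langle>x, s \<cdot> y\<rangle>\<rangle>"
    unfolding orbit_eq by (simp add: h_def act_mult y')
  then have "a \<cdot> \<langle>h, s \<cdot> y\<rangle> = pr2 G X \<cdot> \<langle>h, s \<cdot> y\<rangle>"
    by (simp add: act_inverse_act)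
  moreover have "\<langle>h, s \<cdot> y\<rangle> \<in> hom C Z (G \<otimes> X)"
    by (simp add: in_hom_iff)
  ultimately obtain k where k [simp]: "k \<in> Arr C" "Dom C k = Z" "Cod C k = S"
    and \<iota>k: "\<iota> \<cdot> k = \<langle>h, s \<cdot> y\<rangle>"
    using S unfolding is_stabiliser_def is_equaliser_def in_hom_iff by (metis group_action_simps(13))
  have "s \<cdot> y = (pr2 G X \<cdot> \<iota>) \<cdot> k"
    by (simp add: \<iota>k)
  then obtain w where w [simp]: "w \<in> Arr C" "Dom C w = Z" "Cod C w = P"
    and uw: "u \<cdot> w = y" and vw: "v \<cdot> w = k"
    using pullback_factor[OF P, of y k] by auto
  note pair = stabiliser_pair_pairing[OF q s S P, of x w, simplified uw vw \<iota>k]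
  show thesis
  proof
    show "(Id C G \<otimes>\<^sub>m u) \<cdot> \<langle>x, w\<rangle> = \<alpha>"
      using pair(1) by (simp add: \<alpha>)
    show "((m \<otimes>\<^sub>m q) \<cdot> assoc G G X \<cdot> (Id C G \<otimes>\<^sub>m \<iota>) \<cdot> (Id C G \<otimes>\<^sub>m v)) \<cdot> \<langle>x, w\<rangle> = \<beta>"
      using pair(2) by (simp add: \<beta> xh y' del: Comp_assoc_right)
  qed (simp_all add: Z_def[symmetric])
qed

text \<open>A regular epimorphism is the coequaliser of some pair, which it identifies, and such a pair
  factors through the stabiliser pair; hence an arrow that coequalises the stabiliser pair
  coequalises that pair too and descends.\<close>

lemma orbit_map_coequaliser:
  assumes q: "is_quotient G X a Q q" and s: "is_section q s"
    and S: "is_stabiliser G X a S \<iota>" and P: "is_pullback s (pr2 G X \<cdot> \<iota>) P u v"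
    and epi: "is_regular_epi (a \<cdot> (Id C G \<otimes>\<^sub>m s))"
  shows "is_coequaliser (Id C G \<otimes>\<^sub>m u)
    ((m \<otimes>\<^sub>m q) \<cdot> assoc G G X \<cdot> (Id C G \<otimes>\<^sub>m \<iota>) \<cdot> (Id C G \<otimes>\<^sub>m v)) X (a \<cdot> (Id C G \<otimes>\<^sub>m s))"
    (is "is_coequaliser ?d1 ?d2 X ?c")
proof -
  note [simp] = quotient_simps[OF q] section_simps(1-3)[OF q s]
  have [simp]: "\<iota> \<in> Arr C" "Dom C \<iota> = S" "Cod C \<iota> = G \<otimes> X"
    using S by (auto simp: is_stabiliser_def is_equaliser_def in_hom_iff)
  note [simp] = pullback_simps(4-9)[OF P, simplified]
  have [simp]: "P \<in> Obj C"
    using Dom_in_Obj[of u] by simp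
  have d [simp]: "?d1 \<in> Arr C" "Dom C ?d1 = G \<otimes> P" "Cod C ?d1 = G \<otimes> Q"
    "?d2 \<in> Arr C" "Dom C ?d2 = G \<otimes> P" "Cod C ?d2 = G \<otimes> Q"
    "?c \<in> Arr C" "Dom C ?c = G \<otimes> Q" "Cod C ?c = X"
    by simp_all
  obtain \<alpha> \<beta> where \<alpha>\<beta>: "is_coequaliser \<alpha> \<beta> X ?c"
    using epi by (auto elim: regular_epiE)
  note \<alpha>\<beta>_simps = coequaliser_simps[OF \<alpha>\<beta>]
  obtain t where t: "t \<in> Arr C" "Dom C t = Dom C \<beta>" "Cod C t = G \<otimes> P" "?d1 \<cdot> t = \<alpha>" "?d2 \<cdot> t = \<beta>"
    using orbit_map_eq_factor[OF q s S P, of \<alpha> \<beta>] \<alpha>\<beta>_simps by auto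
  show ?thesis
  proof (rule coequaliserI)
    \<comment> \<open>Evaluated at the universal element \<open>\<langle>g, w\<rangle>\<close> of \<open>G \<otimes> P\<close>, the claim reads \<open>g s(y) = (g h) s(y)\<close>
      with \<open>h\<close> in the stabiliser of \<open>s(y)\<close>.\<close>
    define g where "g = pr1 G P"
    define w where "w = pr2 G P"
    have [simp]: "g \<in> Arr C" "w \<in> Arr C" "Dom C g = G \<otimes> P" "Dom C w = G \<otimes> P" "Cod C g = G" "Cod C w = P"
      by (simp_all add: g_def w_def)
    have gw: "\<langle>g, w\<rangle> = Id C (G \<otimes> P)"
      using pairing_eta[of G P "Id C (G \<otimes> P)"] by (simp add: g_def w_def)
    define h where "h = pr1 G X \<cdot> (\<iota> \<cdot> (v \<cdot> w))"
    have [simp]: "h \<in> Arr C" "Dom C h = G \<otimes> P" "Cod C h = G"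
      by (simp_all add: h_def)
    note pair = stabiliser_pair_pairing[OF q s S P, of g w, folded h_def]
    have "\<langle>h, s \<cdot> (u \<cdot> w)\<rangle> = \<iota> \<cdot> (v \<cdot> w)"
      using pairing_eta[of G X "\<iota> \<cdot> (v \<cdot> w)"] pair(3) by (simp add: h_def)
    then have fix_sy: "a \<cdot> \<langle>h, s \<cdot> (u \<cdot> w)\<rangle> = s \<cdot> (u \<cdot> w)"
      using pair(4) by simp
    have d1: "?d1 = \<langle>g, u \<cdot> w\<rangle>" and d2: "?d2 = \<langle>m \<cdot> \<langle>g, h\<rangle>, u \<cdot> w\<rangle>"
      using pair(1,2) by (simp_all only: gw) simp_all
    have "?c \<cdot> ?d1 = a \<cdot> \<langle>g, s \<cdot> (u \<cdot> w)\<rangle>"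
      unfolding d1 by (rule orbit_map_pairing[OF q s]) simp_all
    also have "\<dots> = a \<cdot> \<langle>m \<cdot> \<langle>g, h\<rangle>, s \<cdot> (u \<cdot> w)\<rangle>"
      by (simp add: act_mult fix_sy)
    also have "\<dots> = ?c \<cdot> ?d2"
      unfolding d2 by (rule orbit_map_pairing[OF q s, symmetric]) simp_all
    finally show "?c \<cdot> ?d1 = ?c \<cdot> ?d2" .
  next
    fix k
    assume k: "k \<in> Arr C" "Dom C k = Cod C ?d1" and kd: "k \<cdot> ?d1 = k \<cdot> ?d2"
    have "(k \<cdot> ?d1) \<cdot> t = (k \<cdot> ?d2) \<cdot> t"
      by (simp only: kd)
    moreover have "(k \<cdot> ?d1) \<cdot> t = k \<cdot> (?d1 \<cdot> t)"
      by (rule Comp_assoc_right) (use k t d in simp_all)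
    moreover have "(k \<cdot> ?d2) \<cdot> t = k \<cdot> (?d2 \<cdot> t)"
      by (rule Comp_assoc_right) (use k t d in simp_all)
    ultimately have "k \<cdot> \<alpha> = k \<cdot> \<beta>"
      by (simp only: t)
    then show "\<exists>h. h \<in> Arr C \<and> Dom C h = X \<and> Cod C h = Cod C k \<and> h \<cdot> ?c = k"
      using coequaliser_factor[OF \<alpha>\<beta>, of k] k d \<alpha>\<beta>_simps by metis
  next
    fix k l
    assume "k \<in> Arr C" "l \<in> Arr C" "Dom C k = X" "Dom C l = X" "Cod C k = Cod C l" "k \<cdot> ?c = l \<cdot> ?c"
    then show "k = l"
      using coequaliser_epi[OF \<alpha>\<beta>] by blast
  qed (use d in simp_all)
qed

end

section \<open>Orbit maps in action Barr-exact categories\<close>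

context regular_category
begin

text \<open>Let \<open>p : G \<otimes> X \<rightarrow> R\<close> be the regular epimorphism onto the orbit relation. A point \<open>z\<close> of \<open>X\<close>
  yields the element \<open>(z, s(q(z)))\<close> of the kernel pair \<open>R\<close>, and its fibre under \<open>p\<close> consists of the
  \<open>g\<close> with \<open>g s(q(z)) = z\<close>. This is the fibre of the orbit map \<open>(g, y) \<mapsto> g s(y)\<close> over \<open>z\<close>,
  as \<open>y\<close> is forced to be \<open>q(z)\<close>. So the orbit map is a pullback of \<open>p\<close>.\<close>

lemma orbit_map_regular_epi:
  assumes G: "is_group_object G m e i" and act: "is_action G m e X a"
    and q: "is_quotient G X a Q q" and s: "is_section q s"
    and R: "is_image_factorisation \<langle>a, pr2 G X\<rangle> R p j"
    and ker: "is_kernel_pair q R (pr1 X X \<cdot> j) (pr2 X X \<cdot> j)"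
  shows "is_regular_epi (a \<cdot> (Id C G \<otimes>\<^sub>m s))"
proof -
  interpret group_action C G m e i X a
    using G act by unfold_locales
  note [simp] = quotient_simps[OF q] section_simps(1-3)[OF q s]
  have [simp]: "p \<in> Arr C" "Dom C p = G \<otimes> X" "Cod C p = R" "j \<in> Arr C" "Dom C j = R" "Cod C j = X \<otimes> X"
    and jp: "j \<cdot> p = \<langle>a, pr2 G X\<rangle>" and p: "is_regular_epi p"
    using R by (auto simp: is_image_factorisation_def in_hom_iff)
  define r1 where "r1 = pr1 X X \<cdot> j"
  define r2 where "r2 = pr2 X X \<cdot> j"
  have [simp]: "r1 \<in> Arr C" "Dom C r1 = R" "Cod C r1 = X" "r2 \<in> Arr C" "Dom C r2 = R" "Cod C r2 = X"
    by (simp_all add: r1_def r2_def)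
  have r1p: "r1 \<cdot> p = a" and r2p: "r2 \<cdot> p = pr2 G X"
    by (simp_all add: r1_def r2_def jp)
  have pb: "is_pullback q q R r1 r2"
    using ker by (simp add: is_kernel_pair_def r1_def r2_def)
  \<comment> \<open>The arrow \<open>t\<close> is \<open>z \<mapsto> (z, s(q(z)))\<close>.\<close>
  have "q \<cdot> Id C X = q \<cdot> (s \<cdot> q)"
    by (simp add: section_right_inverse[OF q s])
  then obtain t where t [simp]: "t \<in> Arr C" "Dom C t = X" "Cod C t = R"
    and r1t: "r1 \<cdot> t = Id C X" and r2t: "r2 \<cdot> t = s \<cdot> q"
    using pullback_factor[OF pb, of "Id C X" "s \<cdot> q"] by auto
  define c where "c = a \<cdot> (Id C G \<otimes>\<^sub>m s)"
  have [simp]: "c \<in> Arr C" "Dom C c = G \<otimes> Q" "Cod C c = X"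
    by (simp_all add: c_def)
  have qc: "q \<cdot> c = pr2 G Q"
    unfolding c_def product_map_def
    by (simp add: quotient_act[OF q] section_right_inverse[OF q s])
  have "is_pullback p t (G \<otimes> Q) (Id C G \<otimes>\<^sub>m s) c"
    unfolding is_pullback_def
  proof (intro conjI allI impI)
    show "p \<cdot> (Id C G \<otimes>\<^sub>m s) = t \<cdot> c"
    proof (rule pullback_joint_mono[OF pb])
      show "r1 \<cdot> (p \<cdot> (Id C G \<otimes>\<^sub>m s)) = r1 \<cdot> (t \<cdot> c)"
        using Comp_assoc_eq[OF r1p, of "Id C G \<otimes>\<^sub>m s"] Comp_assoc_eq[OF r1t, of c]
        by (simp add: c_def)
      show "r2 \<cdot> (p \<cdot> (Id C G \<otimes>\<^sub>m s)) = r2 \<cdot> (t \<cdot> c)"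
        using Comp_assoc_eq[OF r2p, of "Id C G \<otimes>\<^sub>m s"] Comp_assoc_eq[OF r2t, of c]
        by (simp add: qc) (simp add: product_map_def)
    qed simp_all
  next
    fix Z k l
    assume kl: "k \<in> hom C Z (Dom C p) \<and> l \<in> hom C Z (Dom C t) \<and> p \<cdot> k = t \<cdot> l"
    then have [simp]: "k \<in> Arr C" "Dom C k = Z" "Cod C k = G \<otimes> X" "l \<in> Arr C" "Dom C l = Z" "Cod C l = X"
      and pk: "p \<cdot> k = t \<cdot> l"
      by (simp_all add: in_hom_iff)
    have ak: "a \<cdot> k = l"
      using Comp_assoc_eq[OF r1p, of k] Comp_assoc_eq[OF r1t, of l] by (simp add: pk)
    have pr2k: "pr2 G X \<cdot> k = s \<cdot> (q \<cdot> l)"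
      using Comp_assoc_eq[OF r2p, of k] Comp_assoc_eq[OF r2t, of l] by (simp add: pk)
    define h where "h = \<langle>pr1 G X \<cdot> k, q \<cdot> l\<rangle>"
    have [simp]: "h \<in> Arr C" "Dom C h = Z" "Cod C h = G \<otimes> Q"
      by (simp_all add: h_def)
    have sh: "(Id C G \<otimes>\<^sub>m s) \<cdot> h = k"
      using pairing_eta[of G X k] by (simp add: h_def pr2k)
    have ch: "c \<cdot> h = l"
      by (simp add: c_def sh ak)
    have "h' = h" if [simp]: "h' \<in> Arr C" "Dom C h' = Z" "Cod C h' = G \<otimes> Q"
      and sh': "(Id C G \<otimes>\<^sub>m s) \<cdot> h' = k" and ch': "c \<cdot> h' = l" for h'
    proof (rule product_arr_eqI[of G Q])
      have pr1s: "pr1 G X \<cdot> (Id C G \<otimes>\<^sub>m s) = pr1 G Q"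
        by (simp add: product_map_def)
      show "pr1 G Q \<cdot> h' = pr1 G Q \<cdot> h"
        using Comp_assoc_eq[OF pr1s, of h'] Comp_assoc_eq[OF pr1s, of h] by (simp add: sh sh')
      show "pr2 G Q \<cdot> h' = pr2 G Q \<cdot> h"
        using Comp_assoc_eq[OF qc, of h'] Comp_assoc_eq[OF qc, of h] by (simp add: ch ch')
    qed simp_all
    then show "\<exists>!h. h \<in> hom C Z (G \<otimes> Q) \<and> (Id C G \<otimes>\<^sub>m s) \<cdot> h = k \<and> c \<cdot> h = l"
      using sh ch by (intro ex1I[of _ h]) (auto simp: in_hom_iff)
  qed (simp_all add: in_hom_iff)
  then have "is_regular_epi c"
    using p regular_epi_pullback_stable by blast
  then show ?thesis
    by (simp add: c_def)
qed

end

context action_Barr_exact_category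
begin

text \<open>Exactness speaks of the image \<open>R\<close>, quotients are defined by the action; since \<open>a\<close> and \<open>pr2\<close> are
  the projections of \<open>R\<close> precomposed with a regular epimorphism, the two notions of quotient agree.\<close>

lemma quotient_via_image:
  assumes G: "is_group_object G m e i" and act: "is_action G m e X a"
  obtains R p j where "is_image_factorisation \<langle>a, pr2 G X\<rangle> R p j"
    "\<And>Q q. is_quotient G X a Q q \<longleftrightarrow> is_coequaliser (pr1 X X \<cdot> j) (pr2 X X \<cdot> j) Q q"
    "is_effective R (pr1 X X \<cdot> j) (pr2 X X \<cdot> j)"
proof -
  interpret group_action C G m e i X a
    using G act by unfold_locales
  obtain R p j where R: "is_image_factorisation \<langle>a, pr2 G X\<rangle> R p j"
    using image_factorisation_exists[of "\<langle>a, pr2 G X\<rangle>"] by auto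
  then have [simp]: "p \<in> Arr C" "Dom C p = G \<otimes> X" "Cod C p = R" "j \<in> Arr C" "Dom C j = R" "Cod C j = X \<otimes> X"
    and jp: "j \<cdot> p = \<langle>a, pr2 G X\<rangle>" and p: "is_regular_epi p"
    by (auto simp: is_image_factorisation_def in_hom_iff)
  have "is_quotient G X a Q q \<longleftrightarrow> is_coequaliser (pr1 X X \<cdot> j) (pr2 X X \<cdot> j) Q q" for Q q
    using coequaliser_precomp_regular_epi[OF p, of "pr1 X X \<cdot> j" "pr2 X X \<cdot> j" Q q]
    by (simp add: is_quotient_def jp)
  then show thesis
    using that R action_image_effective[OF G act R] by blast
qed

end

theorem proposition2p20:
  fixes C :: "('o, 'm) cat"
  assumes "action_Barr_exact_category C"
  shows "OST_category C"
proof -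
  interpret action_Barr_exact_category C
    by (rule assms)
  show ?thesis
  proof unfold_locales
    fix G m e i X a
    assume G: "is_group_object G m e i" and act: "is_action G m e X a"
    show "\<exists>Q q. is_quotient G X a Q q"
      using quotient_via_image[OF G act] unfolding is_effective_def by metis
  next
    fix G m e i X a Q q s S \<iota> P u v
    assume G: "is_group_object G m e i" and act: "is_action G m e X a"
      and q: "is_quotient G X a Q q" and s: "is_section q s"
      and S: "is_stabiliser G X a S \<iota>" and P: "is_pullback s (pr2 G X \<cdot>\<^bsub>C\<^esub> \<iota>) P u v"
    interpret group_action C G m e i X a
      using G act by unfold_locales
    obtain R p j where R: "is_image_factorisation \<langle>a, pr2 G X\<rangle> R p j"
      and quot: "\<And>Q q. is_quotient G X a Q q \<longleftrightarrow>
        is_coequaliser (pr1 X X \<cdot>\<^bsub>C\<^esub> j) (pr2 X X \<cdot>\<^bsub>C\<^esub> j) Q q"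
      and eff: "is_effective R (pr1 X X \<cdot>\<^bsub>C\<^esub> j) (pr2 X X \<cdot>\<^bsub>C\<^esub> j)"
      using quotient_via_image[OF G act] by metis
    have "is_kernel_pair q R (pr1 X X \<cdot>\<^bsub>C\<^esub> j) (pr2 X X \<cdot>\<^bsub>C\<^esub> j)"
      using eff q effective_kernel_pair unfolding is_effective_def quot by blast
    then have "is_regular_epi (a \<cdot>\<^bsub>C\<^esub> (Id C G \<otimes>\<^sub>m s))"
      by (rule orbit_map_regular_epi[OF G act q s R])
    then show "is_coequaliser (Id C G \<otimes>\<^sub>m u)
        ((m \<otimes>\<^sub>m q) \<cdot>\<^bsub>C\<^esub> assoc G G X \<cdot>\<^bsub>C\<^esub> (Id C G \<otimes>\<^sub>m \<iota>) \<cdot>\<^bsub>C\<^esub> (Id C G \<otimes>\<^sub>m v)) X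
        (a \<cdot>\<^bsub>C\<^esub> (Id C G \<otimes>\<^sub>m s))"
      by (rule orbit_map_coequaliser[OF q s S P])
  qed
qed

end
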